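(* Let $\Omega\subseteq\mathbb R^{1+n}$ be a domain whose projection onto the time axis is all of $\mathbb R$, let $f\in C(\Omega,\mathbb R^n)$, and suppose every solution of $\dot x=f(t,x)$ has the uniqueness property. Let $\tilde\Omega\subset\Omega$ and $$\tilde\Omega^*:=\{(t,x,y)\in\mathbb R\times\mathbb R^{2n}:(t,x)\in\tilde\Omega,\ (t,y)\in\tilde\Omega\}.$$ Suppose there exist functions $V\in C^1(\mathbb R^{1+n},\mathbb R)$, $U\in C^1(\tilde\Omega^*,\mathbb R)$, $\eta\in C(\mathbb R_+,\mathbb R_+)$ and $\beta\in C(\mathbb R\times\mathbb R_+,\mathbb R_+)$ such that: 1) $V$ is spatially coercive and $\eta$ is positive-definite; 2) the function $\dot U_{(f,f)}(t,x,y):=\frac{\partial U(t,x,y)}{\partial t}+\frac{\partial U(t,x,y)}{\partial x}\cdot f(t,x)+\frac{\partial U(t,x,y)}{\partial y}\cdot f(t,y)$ satisfies $$\dot U_{(f,f)}(t,x,y)\ge\beta(t,r)\,\eta(|U(t,x,y)|)\quad\forall (x,y)\in\tilde V_t^{-1}((-\infty,r])\cap\tilde\Omega^*_t$$ (for all $t\in\mathbb R$, $r\ge0$), where $\tilde V(t,x,y):=\max\{V(t,x),V(t,y)\}$, and $\dot U_{(f,f)}$ takes a positive value at every point $(t,x,y)\in\tilde\Omega^*$ such that $x\ne y$ and $U(t,x,y)=0$ (if the set of such points is nonempty); 3) for every sufficiently large $r\ge0$, the functions $\beta$, $h(u):=\int_1^u\frac{ds}{\eta(s)}$ ($u>0$),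 and $$b(t,r):=\max\{|U(t,x,y)|:(x,y)\in\tilde V_t^{-1}((-\infty,r])\cap\tilde\Omega^*_t\}$$ satisfy $$\int_0^{\pm\infty}\beta(s,r)\,ds=\pm\infty,\qquad \liminf_{t\to\pm\infty}\frac{h(b(t,r))}{\left|\int_0^t\beta(s,r)\,ds\right|}<1 .$$ Then the system $\dot x=f(t,x)$ cannot have two different V-bounded solutions $x(t)$, $y(t)$, $t\in\mathbb R$, whose graphs lie in $\tilde\Omega$.
   Context: $\mathbb R_+=[0,\infty)$. For a function $G(t,\cdot)$ put $G_t:=G(t,\cdot)$; for a set $\mathcal A$ in (time)$\times$(space), $\mathcal A_t$ is its slice at time $t$. A function $V\in C(\mathbb R\times\mathbb R^n,\mathbb R)$ is spatially coercive if for every $t$ the set $V_t^{-1}(0)$ is nonempty and $\lim_{\|x\|\to\infty}V_t(x)=\infty$. A solution $x(t)$, $t\in\mathbb R$, is V-bounded if $\sup_{t\in\mathbb R}V(t,x(t))<\infty$. Positive-definite means $\eta(0)=0$ and $\eta(u)>0$ for $u>0$. Conditions with $\pm$ are required for both signs. The value $h(0)$ is understood as $\lim_{u\to0+}h(u)\in[-\infty,0)$. The maximum defining $b(t,r)$ is assumed to exist. *)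

theory Defs
  imports "HOL-Analysis.Analysis"
begin

definition solution_on ::
  "(real \<times> 'a::real_normed_vector) set \<Rightarrow> (real \<Rightarrow> 'a \<Rightarrow> 'a) \<Rightarrow> real set \<Rightarrow> (real \<Rightarrow> 'a) \<Rightarrow> bool"
  where "solution_on \<Omega> f I x \<longleftrightarrow> is_interval I \<and>
    (\<forall>t\<in>I. (t, x t) \<in> \<Omega> \<and> (x has_vector_derivative f t (x t)) (at t within I))"

definition uniqueness_property ::
  "(real \<times> 'a::real_normed_vector) set \<Rightarrow> (real \<Rightarrow> 'a \<Rightarrow> 'a) \<Rightarrow> bool"
  where "uniqueness_property \<Omega> f \<longleftrightarrow>
    (\<forall>I J x y t\<^sub>0. solution_on \<Omega> f I x \<longrightarrow> solution_on \<Omega> f J y \<longrightarrow>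
       t\<^sub>0 \<in> I \<inter> J \<longrightarrow> x t\<^sub>0 = y t\<^sub>0 \<longrightarrow> (\<forall>t\<in>I \<inter> J. x t = y t))"

text \<open>
  \<open>has_C1_derivative_on F F' S\<close>: \<open>F\<close> is of class $C^1$ on \<open>S\<close> with differential \<open>F'\<close>.
  If \<open>S\<close> is open, \<open>F'\<close> is determined on \<open>S\<close> by \<open>F\<close>.  For a general set \<open>S\<close> the differential
  is relative to \<open>S\<close> and need not be unique, so it is an explicit argument; the restriction to
  \<open>S\<close> of a $C^1$ function on an open neighbourhood of \<open>S\<close>, with its usual differential, is a
  special case.
\<close>

definition has_C1_derivative_on ::
  "('a::real_normed_vector \<Rightarrow> 'b::real_normed_vector) \<Rightarrow> ('a \<Rightarrow> 'a \<Rightarrow>\<^sub>L 'b) \<Rightarrow> 'a set \<Rightarrow> bool"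
  where "has_C1_derivative_on F F' S \<longleftrightarrow>
    (\<forall>p\<in>S. (F has_derivative blinfun_apply (F' p)) (at p within S)) \<and> continuous_on S F'"

definition slice :: "(real \<times> 'a) set \<Rightarrow> real \<Rightarrow> 'a set"
  where "slice A t = {x. (t, x) \<in> A}"

definition star :: "(real \<times> 'a) set \<Rightarrow> (real \<times> 'a \<times> 'a) set"
  where "star A = {(t, x, y). (t, x) \<in> A \<and> (t, y) \<in> A}"

definition spatially_coercive :: "(real \<times> 'a::real_normed_vector \<Rightarrow> real) \<Rightarrow> bool"
  where "spatially_coercive V \<longleftrightarrow> continuous_on UNIV V \<and>
    (\<forall>t. (\<exists>x. V (t, x) = 0) \<and> filterlim (\<lambda>x. V (t, x)) at_top at_infinity)"

definition V_bounded :: "(real \<times> 'a \<Rightarrow> real) \<Rightarrow> (real \<Rightarrow> 'a) \<Rightarrow> bool"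
  where "V_bounded V x \<longleftrightarrow> bdd_above (range (\<lambda>t. V (t, x t)))"

definition positive_definite :: "(real \<Rightarrow> real) \<Rightarrow> bool"
  where "positive_definite \<eta> \<longleftrightarrow> \<eta> 0 = 0 \<and> (\<forall>u>0. \<eta> u > 0)"

definition max_fun :: "(real \<times> 'a \<Rightarrow> real) \<Rightarrow> real \<times> 'a \<times> 'a \<Rightarrow> real"
  where "max_fun V = (\<lambda>(t, x, y). max (V (t, x)) (V (t, y)))"

definition sublevel_pairs ::
  "(real \<times> 'a \<Rightarrow> real) \<Rightarrow> (real \<times> 'a) set \<Rightarrow> real \<Rightarrow> real \<Rightarrow> ('a \<times> 'a) set"
  where "sublevel_pairs V A t r = curry (max_fun V) t -` {..r} \<inter> slice (star A) t"

text \<open>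
  The three summands are $\partial U/\partial t$, $\partial U/\partial x \cdot f(t,x)$ and
  $\partial U/\partial y \cdot f(t,y)$, where \<open>U'\<close> is the differential of \<open>U\<close>.
\<close>

definition U_dot ::
  "(real \<times> 'a \<times> 'a \<Rightarrow> (real \<times> 'a \<times> 'a) \<Rightarrow>\<^sub>L real) \<Rightarrow> (real \<Rightarrow> 'a \<Rightarrow> 'a::real_normed_vector) \<Rightarrow>
    real \<Rightarrow> 'a \<Rightarrow> 'a \<Rightarrow> real"
  where "U_dot U' f t x y =
    blinfun_apply (U' (t, x, y)) (1, 0, 0)
    + blinfun_apply (U' (t, x, y)) (0, f t x, 0)
    + blinfun_apply (U' (t, x, y)) (0, 0, f t y)"

definition is_maximum :: "real set \<Rightarrow> real \<Rightarrow> bool"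
  where "is_maximum A m \<longleftrightarrow> m \<in> A \<and> (\<forall>a\<in>A. a \<le> m)"

definition U_values ::
  "(real \<times> 'a \<Rightarrow> real) \<Rightarrow> (real \<times> 'a \<times> 'a \<Rightarrow> real) \<Rightarrow> (real \<times> 'a) set \<Rightarrow> real \<Rightarrow> real \<Rightarrow> real set"
  where "U_values V U A t r = (\<lambda>(x, y). \<bar>U (t, x, y)\<bar>) ` sublevel_pairs V A t r"

text \<open>Only meaningful where the maximum exists.\<close>

definition b_fun ::
  "(real \<times> 'a \<Rightarrow> real) \<Rightarrow> (real \<times> 'a \<times> 'a \<Rightarrow> real) \<Rightarrow> (real \<times> 'a) set \<Rightarrow> real \<Rightarrow> real \<Rightarrow> real"
  where "b_fun V U A t r = (THE m. is_maximum (U_values V U A t r) m)"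

text \<open>Interval integrals are oriented, so the integral is negative for \<open>0 < u < 1\<close>.\<close>

definition h_fun :: "(real \<Rightarrow> real) \<Rightarrow> real \<Rightarrow> ereal"
  where "h_fun \<eta> u =
    (if u > 0 then ereal (LBINT s=1..ereal u. 1 / \<eta> s)
     else Lim (at_right 0) (\<lambda>v. ereal (LBINT s=1..ereal v. 1 / \<eta> s)))"

definition beta_int :: "(real \<Rightarrow> real \<Rightarrow> real) \<Rightarrow> real \<Rightarrow> real \<Rightarrow> real"
  where "beta_int \<beta> r t = (LBINT s=0..ereal t. \<beta> s r)"

end

theory Submission
  imports Defs
begin

text \<open>
  Along two different solutions staying in a common sublevel set of \<open>V\<close>, the function
  \<open>u t = U (t, x t, y t)\<close> satisfies \<open>u' \<ge> \<beta> \<eta>(\<bar>u\<bar>) \<ge> 0\<close> and \<open>u' > 0\<close> at its zeros, so \<open>u\<close> is not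
  identically zero.  If \<open>u t\<^sub>0 > 0\<close>, then \<open>u\<close> stays positive to the right of \<open>t\<^sub>0\<close>, and dividing by
  \<open>\<eta>(u)\<close> and integrating gives \<open>h (b t) \<ge> h (u t) \<ge> \<integral>\<^sub>0\<^sup>t \<beta> + C\<close>, which forces the lower limit
  of the quotient at \<open>+\<infinity>\<close> to be at least 1.  If \<open>u t\<^sub>0 < 0\<close>, the same argument for \<open>- u (- t)\<close>
  contradicts the condition at \<open>-\<infinity>\<close>.
\<close>

text \<open>The fundamental theorem of calculus for an oriented integral, with the base point
  \<open>c\<close> on either side of \<open>u\<close>. It serves both for \<open>H\<close>, based at
  1 on the open half-line, and for the primitive of \<open>\<beta>\<close>, based at 0 on the whole
  line.\<close>

lemma interval_integral_has_real_derivative: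
  fixes g :: "real \<Rightarrow> real"
  assumes "continuous_on A g" "open A" "is_interval A" "c \<in> A" "u \<in> A"
  shows "((\<lambda>v. LBINT s=ereal c..ereal v. g s) has_real_derivative g u) (at u)"
proof -
  obtain e where e: "e > 0" "cball u e \<subseteq> A"
    using assms(2,5) open_contains_cball by blast
  \<comment> \<open>The interval \<open>{a..b}\<close> is made to contain the base point
    \<open>c\<close> and to have \<open>u\<close> in its interior, so the derivative within it
    becomes a two-sided one.\<close>
  define a where "a = min c (u - e)"
  define b where "b = max c (u + e)"
  have "a \<in> A" "b \<in> A"
    using e assms(4) by (auto simp: a_def b_def min_def max_def dist_real_def subset_eq)
  then have sub: "{a..b} \<subseteq> A"
    using assms(3) unfolding is_interval_1 by (meson atLeastAtMost_iff subsetI)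
  have ord: "a \<le> c" "c \<le> b" "a < u" "u < b"
    using e by (auto simp: a_def b_def)
  have "((\<lambda>v. LBINT s=c..v. g s) has_vector_derivative g u) (at u within {a..b})"
    using interval_integral_FTC2[of a c b g u] ord continuous_on_subset[OF assms(1) sub] by auto
  moreover have "at u within {a..b} = at u"
    using ord by (intro at_within_interior) auto
  ultimately show ?thesis
    by (simp add: has_real_derivative_iff_has_vector_derivative)
qed

text \<open>Separation of variables: \<open>v\<close> is nondecreasing, hence stays positive, and
  there \<open>H (v s) - B s\<close> has derivative \<open>v' s / \<eta> (v s) - \<beta> s\<close>,
  which is nonnegative. Only times to the right of \<open>t\<^sub>0\<close> enter; the other time
  direction is covered by reflection.\<close>

lemma comparison_lower_bound:
  fixes v v' \<beta> B H \<eta> :: "real \<Rightarrow> real"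
  assumes v: "\<And>t. t \<ge> t\<^sub>0 \<Longrightarrow> (v has_real_derivative v' t) (at t)"
    and B: "\<And>t. t \<ge> t\<^sub>0 \<Longrightarrow> (B has_real_derivative \<beta> t) (at t)"
    and H: "\<And>u. u > 0 \<Longrightarrow> (H has_real_derivative 1 / \<eta> u) (at u)"
    and \<eta>: "\<And>u. u > 0 \<Longrightarrow> \<eta> u > 0"
    and v': "\<And>t. t \<ge> t\<^sub>0 \<Longrightarrow> v' t \<ge> \<beta> t * \<eta> \<bar>v t\<bar>"
    and v'_nonneg: "\<And>t. t \<ge> t\<^sub>0 \<Longrightarrow> v' t \<ge> 0"
    and pos: "v t\<^sub>0 > 0"
    and t: "t \<ge> t\<^sub>0"
  shows "v t > 0" "H (v t) \<ge> H (v t\<^sub>0) - B t\<^sub>0 + B t"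
proof -
  have vpos: "v s > 0" if "s \<ge> t\<^sub>0" for s
  proof -
    have "v t\<^sub>0 \<le> v s"
      by (rule DERIV_nonneg_imp_nondecreasing[OF that]) (use v v'_nonneg in blast)
    then show ?thesis using pos by simp
  qed
  then show "v t > 0" using t by blast
  have "H (v t\<^sub>0) - B t\<^sub>0 \<le> H (v t) - B t"
  proof (rule DERIV_nonneg_imp_nondecreasing[OF t])
    fix s assume s: "t\<^sub>0 \<le> s" "s \<le> t"
    have "((\<lambda>s. H (v s) - B s) has_real_derivative 1 / \<eta> (v s) * v' s - \<beta> s) (at s)"
      using DERIV_chain2[OF H[OF vpos[OF s(1)]] v[OF s(1)]] B[OF s(1)] by (rule DERIV_diff)
    moreover have "1 / \<eta> (v s) * v' s - \<beta> s \<ge> 0"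
      using v'[OF s(1)] \<eta>[OF vpos[OF s(1)]] vpos[OF s(1)] by (simp add: field_simps)
    ultimately show "\<exists>y. ((\<lambda>s. H (v s) - B s) has_real_derivative y) (at s) \<and> 0 \<le> y"
      by blast
  qed
  then show "H (v t) \<ge> H (v t\<^sub>0) - B t\<^sub>0 + B t" by simp
qed

text \<open>Eventually the quotient is bounded below by \<open>C / \<bar>B t\<bar> + 1\<close>, and
  an additive constant is negligible against a divergent denominator. The filter is general in order
  to serve both infinities.\<close>

lemma Liminf_quotient_ge_1:
  fixes B :: "'a \<Rightarrow> real" and g :: "'a \<Rightarrow> ereal"
  assumes lim: "filterlim (\<lambda>t. \<bar>B t\<bar>) at_top F" and "F \<noteq> bot"
    and ge: "\<forall>\<^sub>F t in F. g t \<ge> ereal (C + \<bar>B t\<bar>)"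
  shows "Liminf F (\<lambda>t. g t / ereal \<bar>B t\<bar>) \<ge> 1"
proof -
  have "((\<lambda>t. C / \<bar>B t\<bar> + 1) \<longlongrightarrow> 0 + 1) F"
    by (intro tendsto_intros tendsto_divide_0[where c = C] filterlim_at_top_imp_at_infinity lim)
  then have "((\<lambda>t. ereal (C / \<bar>B t\<bar> + 1)) \<longlongrightarrow> 1) F"
    by (simp add: one_ereal_def)
  then have "Liminf F (\<lambda>t. ereal (C / \<bar>B t\<bar> + 1)) = 1"
    using lim_imp_Liminf \<open>F \<noteq> bot\<close> by blast
  moreover have "\<forall>\<^sub>F t in F. ereal (C / \<bar>B t\<bar> + 1) \<le> g t / ereal \<bar>B t\<bar>"
    using ge filterlim_at_top_dense[THEN iffD1, OF lim, rule_format, of 0]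
  proof eventually_elim
    case (elim t)
    have "ereal (C / \<bar>B t\<bar> + 1) = ereal (C + \<bar>B t\<bar>) / ereal \<bar>B t\<bar>"
      using elim(2) by (simp add: field_simps)
    also have "\<dots> \<le> g t / ereal \<bar>B t\<bar>"
      using elim by (intro ereal_divide_right_mono) auto
    finally show ?case .
  qed
  ultimately show ?thesis
    using Liminf_mono by metis
qed

text \<open>Chain rule along the curve \<open>(t, x t, y t)\<close>, whose velocity
  \<open>(1, f t (x t), f t (y t))\<close> splits by linearity into the three summands of
  \<open>U_dot\<close>.\<close>

lemma has_real_derivative_along_solutions:
  assumes U: "has_C1_derivative_on U U' (star A)"
    and x: "solution_on \<Omega> f UNIV x" and y: "solution_on \<Omega> f UNIV y"
    and mem: "\<And>t. (t, x t) \<in> A" "\<And>t. (t, y t) \<in> A"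
  shows "((\<lambda>t. U (t, x t, y t)) has_real_derivative U_dot U' f t (x t) (y t)) (at t)"
proof -
  let ?p = "\<lambda>t. (t, x t, y t)"
  have dx: "(x has_vector_derivative f t (x t)) (at t)"
    and dy: "(y has_vector_derivative f t (y t)) (at t)"
    using x y by (auto simp: solution_on_def)
  have dp: "(?p has_derivative (\<lambda>h. (h, h *\<^sub>R f t (x t), h *\<^sub>R f t (y t)))) (at t)"
    using dx dy unfolding has_vector_derivative_def by (auto intro!: derivative_eq_intros)
  have range: "?p ` UNIV \<subseteq> star A"
    using mem by (auto simp: star_def)
  \<comment> \<open>The differential is only relative to \<open>star A\<close>, which may fail to be
    open; it restricts to the range of the curve, and this suffices for the chain rule.\<close>
  then have "(U has_derivative blinfun_apply (U' (?p t))) (at (?p t) within ?p ` UNIV)"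
    using U unfolding has_C1_derivative_on_def by (meson has_derivative_subset rangeI subsetD)
  from diff_chain_within[OF dp this]
  have "((\<lambda>t. U (?p t)) has_derivative
      (\<lambda>h. U' (?p t) (h, h *\<^sub>R f t (x t), h *\<^sub>R f t (y t)))) (at t)"
    by (simp add: o_def)
  moreover have "U' (?p t) (h, h *\<^sub>R f t (x t), h *\<^sub>R f t (y t)) = U_dot U' f t (x t) (y t) * h" for h
  proof -
    have "(h, h *\<^sub>R f t (x t), h *\<^sub>R f t (y t)) =
        h *\<^sub>R ((1, 0, 0) + (0, f t (x t), 0) + (0, 0, f t (y t)))"
      by simp
    then show ?thesis
      by (simp only: blinfun.scaleR_right blinfun.add_right U_dot_def) simp
  qed
  ultimately show ?thesis
    unfolding has_field_derivative_def by (simp add: mult.commute[of _ "U_dot U' f t (x t) (y t)"])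
qed

lemma is_maximum_b_fun:
  assumes "is_maximum (U_values V U A t r) m"
  shows "is_maximum (U_values V U A t r) (b_fun V U A t r)"
  unfolding b_fun_def
  by (rule theI, rule assms) (use assms in \<open>auto simp: is_maximum_def intro: antisym\<close>)

theorem theorem2:
  fixes \<Omega> \<Omega>' :: "(real \<times> (real ^ 'n)) set"
    and f :: "real \<Rightarrow> (real ^ 'n) \<Rightarrow> (real ^ 'n)"
    and V :: "real \<times> (real ^ 'n) \<Rightarrow> real"
    and U :: "real \<times> (real ^ 'n) \<times> (real ^ 'n) \<Rightarrow> real"
    and U' :: "real \<times> (real ^ 'n) \<times> (real ^ 'n) \<Rightarrow> (real \<times> (real ^ 'n) \<times> (real ^ 'n)) \<Rightarrow>\<^sub>L real"
    and \<eta> :: "real \<Rightarrow> real"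
    and \<beta> :: "real \<Rightarrow> real \<Rightarrow> real"
  assumes "open \<Omega>" and "connected \<Omega>" and "fst ` \<Omega> = UNIV"
    and "continuous_on \<Omega> (\<lambda>(t, x). f t x)"
    and "uniqueness_property \<Omega> f"
    and "\<Omega>' \<subseteq> \<Omega>"
    and "\<exists>V'. has_C1_derivative_on V V' UNIV"
    and "has_C1_derivative_on U U' (star \<Omega>')"
    and "continuous_on {0..} \<eta>" and "\<forall>u\<ge>0. \<eta> u \<ge> 0"
    and "continuous_on (UNIV \<times> {0..}) (\<lambda>(t, r). \<beta> t r)" and "\<forall>t. \<forall>r\<ge>0. \<beta> t r \<ge> 0"
    and "spatially_coercive V"
    and "positive_definite \<eta>"
    and "\<forall>t. \<forall>r\<ge>0. \<forall>(x, y)\<in>sublevel_pairs V \<Omega>' t r.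
           U_dot U' f t x y \<ge> \<beta> t r * \<eta> \<bar>U (t, x, y)\<bar>"
    and "\<forall>(t, x, y)\<in>star \<Omega>'. x \<noteq> y \<and> U (t, x, y) = 0 \<longrightarrow> U_dot U' f t x y > 0"
    and "\<forall>\<^sub>F r in at_top.
           (\<forall>t. \<exists>m. is_maximum (U_values V U \<Omega>' t r) m) \<and>
           filterlim (beta_int \<beta> r) at_top at_top \<and>
           filterlim (beta_int \<beta> r) at_bot at_bot \<and>
           Liminf at_top (\<lambda>t. h_fun \<eta> (b_fun V U \<Omega>' t r) / ereal \<bar>beta_int \<beta> r t\<bar>) < 1 \<and>
           Liminf at_bot (\<lambda>t. h_fun \<eta> (b_fun V U \<Omega>' t r) / ereal \<bar>beta_int \<beta> r t\<bar>) < 1"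
  shows "\<not> (\<exists>x y. x \<noteq> y \<and>
           solution_on \<Omega> f UNIV x \<and> solution_on \<Omega> f UNIV y \<and>
           V_bounded V x \<and> V_bounded V y \<and>
           (\<forall>t. (t, x t) \<in> \<Omega>') \<and> (\<forall>t. (t, y t) \<in> \<Omega>'))"
proof
  assume "\<exists>x y. x \<noteq> y \<and>
           solution_on \<Omega> f UNIV x \<and> solution_on \<Omega> f UNIV y \<and>
           V_bounded V x \<and> V_bounded V y \<and>
           (\<forall>t. (t, x t) \<in> \<Omega>') \<and> (\<forall>t. (t, y t) \<in> \<Omega>')"
  then obtain x y where "x \<noteq> y"
    and x: "solution_on \<Omega> f UNIV x" and y: "solution_on \<Omega> f UNIV y"
    and bounded: "V_bounded V x" "V_bounded V y"
    and mem: "\<And>t. (t, x t) \<in> \<Omega>'" "\<And>t. (t, y t) \<in> \<Omega>'"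
    by blast
  \<comment> \<open>By uniqueness, solutions that differ somewhere differ at every time, as the
    positivity of \<open>U_dot\<close> at the zeros of \<open>U\<close> demands.\<close>
  have neq: "x t \<noteq> y t" for t
  proof
    assume "x t = y t"
    then have "\<forall>s\<in>UNIV \<inter> UNIV. x s = y s"
      using assms(5)[unfolded uniqueness_property_def, rule_format, OF x y, of t] by simp
    then show False using \<open>x \<noteq> y\<close> by auto
  qed
  obtain c where c: "V (t, x t) \<le> c" for t
    using bounded(1) unfolding V_bounded_def bdd_above_def by blast
  obtain d where d: "V (t, y t) \<le> d" for t
    using bounded(2) unfolding V_bounded_def bdd_above_def by blast
  \<comment> \<open>One level \<open>r\<close> is chosen large enough for condition 3, nonnegative,
    and above the bounds of \<open>V\<close> along both solutions.\<close>
  from eventually_happens'[OF trivial_limit_at_top_linorder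
      eventually_conj[OF assms(17) eventually_ge_at_top[of "max 0 (max c d)"]]]
  obtain r where r: "r \<ge> 0" "c \<le> r" "d \<le> r"
    and max_ex: "\<And>t. \<exists>m. is_maximum (U_values V U \<Omega>' t r) m"
    and lim_top: "filterlim (beta_int \<beta> r) at_top at_top"
    and lim_bot: "filterlim (beta_int \<beta> r) at_bot at_bot"
    and Liminf_top: "Liminf at_top (\<lambda>t. h_fun \<eta> (b_fun V U \<Omega>' t r) / ereal \<bar>beta_int \<beta> r t\<bar>) < 1"
    and Liminf_bot: "Liminf at_bot (\<lambda>t. h_fun \<eta> (b_fun V U \<Omega>' t r) / ereal \<bar>beta_int \<beta> r t\<bar>) < 1"
    by auto

  define u where "u = (\<lambda>t. U (t, x t, y t))"
  define u' where "u' = (\<lambda>t. U_dot U' f t (x t) (y t))"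
  \<comment> \<open>The real-valued form of \<open>h_fun \<eta>\<close> on positive
    arguments.\<close>
  define H where "H = (\<lambda>v. LBINT s=ereal 1..ereal v. 1 / \<eta> s)"
  let ?B = "beta_int \<beta> r" and ?b = "\<lambda>t. b_fun V U \<Omega>' t r"

  have du: "(u has_real_derivative u' t) (at t)" for t
    unfolding u_def u'_def
    by (rule has_real_derivative_along_solutions[OF assms(8) x y mem])
  have pair: "(x t, y t) \<in> sublevel_pairs V \<Omega>' t r" for t
    using mem order_trans[OF c r(2)] order_trans[OF d r(3)]
    by (auto simp: sublevel_pairs_def slice_def star_def max_fun_def)
  have u'_ge: "u' t \<ge> \<beta> t r * \<eta> \<bar>u t\<bar>" for t
    using assms(15) r(1) pair[of t] unfolding u_def u'_def by fastforce
  have u'_nonneg: "u' t \<ge> 0" for t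
  proof -
    have "0 \<le> \<beta> t r * \<eta> \<bar>u t\<bar>" using assms(10,12) r(1) by simp
    then show ?thesis using u'_ge[of t] by linarith
  qed
  have u'_pos: "u' t > 0" if "u t = 0" for t
    using assms(16) mem neq[of t] that by (auto simp: u_def u'_def star_def)
  have u_le: "\<bar>u t\<bar> \<le> ?b t" for t
  proof -
    have "\<bar>u t\<bar> \<in> U_values V U \<Omega>' t r"
      using imageI[OF pair[of t], of "\<lambda>(x, y). \<bar>U (t, x, y)\<bar>"] by (simp add: U_values_def u_def)
    moreover obtain m where "is_maximum (U_values V U \<Omega>' t r) m"
      using max_ex by blast
    ultimately show ?thesis
      using is_maximum_b_fun is_maximum_def by metis
  qed

  have \<eta>_pos: "\<eta> v > 0" if "v > 0" for v
    using assms(14) that by (simp add: positive_definite_def)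
  \<comment> \<open>The integrand may blow up at 0, where \<open>\<eta>\<close> vanishes, so the
    derivative is taken on the open half-line.\<close>
  have dH: "(H has_real_derivative 1 / \<eta> v) (at v)" if "v > 0" for v
    unfolding H_def
  proof (rule interval_integral_has_real_derivative[where A = "{0<..}"])
    have "continuous_on {0<..} \<eta>"
      by (rule continuous_on_subset[OF assms(9)]) auto
    then show "continuous_on {0<..} (\<lambda>s. 1 / \<eta> s)"
      by (intro continuous_intros) (use \<eta>_pos in fastforce)+
  qed (use that in \<open>auto simp: is_interval_1\<close>)
  have dB: "(?B has_real_derivative \<beta> t r) (at t)" for t
  proof -
    have "continuous_on UNIV ((\<lambda>(t, r). \<beta> t r) \<circ> (\<lambda>t. (t, r)))"
      using r(1) by (intro continuous_on_compose continuous_intros continuous_on_subset[OF assms(11)]) auto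
    then show ?thesis
      unfolding beta_int_def zero_ereal_def
      by (intro interval_integral_has_real_derivative[where A = UNIV]) (auto simp: o_def)
  qed
  \<comment> \<open>A nonzero \<open>u t\<close> forces the maximum \<open>?b t\<close> to be
    positive, so \<open>h_fun\<close> is given by its integral branch; \<open>H\<close> is monotone
    there because its derivative \<open>1 / \<eta> v\<close> is positive.\<close>
  have h_ge: "h_fun \<eta> (?b t) \<ge> ereal (H \<bar>u t\<bar>)" if "u t \<noteq> 0" for t
  proof -
    have "?b t > 0" using u_le[of t] that by linarith
    moreover have "H \<bar>u t\<bar> \<le> H (?b t)"
    proof (rule DERIV_nonneg_imp_nondecreasing[OF u_le])
      fix v assume "\<bar>u t\<bar> \<le> v"
      then have "v > 0" using that by linarith
      then show "\<exists>D. (H has_real_derivative D) (at v) \<and> 0 \<le> D"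
        using dH \<eta>_pos by (intro exI[of _ "1 / \<eta> v"]) (simp add: less_imp_le)
    qed
    ultimately show ?thesis
      by (simp add: h_fun_def H_def one_ereal_def)
  qed

  \<comment> \<open>If \<open>u\<close> vanished identically, \<open>u' 0\<close> would be both zero
    and positive.\<close>
  obtain t\<^sub>0 where "u t\<^sub>0 \<noteq> 0"
  proof (rule ccontr)
    assume *: "\<not> thesis"
    then have "u = (\<lambda>_. 0)" using that by blast
    then have "u' 0 = 0"
      using du[of 0] DERIV_const DERIV_unique by metis
    then show False using u'_pos[of 0] \<open>u = (\<lambda>_. 0)\<close> by simp
  qed
  then consider "u t\<^sub>0 > 0" | "u t\<^sub>0 < 0" by linarith
  then show False
  proof cases
    case 1
    \<comment> \<open>The constant comes from the comparison started at \<open>t\<^sub>0\<close>;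
      eventually \<open>?B t\<close> is nonnegative and equals its absolute value.\<close>
    have "\<forall>\<^sub>F t in at_top. h_fun \<eta> (?b t) \<ge> ereal (H (u t\<^sub>0) - ?B t\<^sub>0 + \<bar>?B t\<bar>)"
      using eventually_ge_at_top[of t\<^sub>0] filterlim_at_top[THEN iffD1, OF lim_top, rule_format, of 0]
    proof eventually_elim
      case (elim t)
      note * = comparison_lower_bound[of t\<^sub>0 u u' ?B "\<lambda>t. \<beta> t r" H \<eta>,
          OF du dB dH \<eta>_pos u'_ge u'_nonneg 1 elim(1)]
      then have "ereal (H (u t\<^sub>0) - ?B t\<^sub>0 + \<bar>?B t\<bar>) \<le> ereal (H \<bar>u t\<bar>)"
        using elim(2) by simp
      also have "\<dots> \<le> h_fun \<eta> (?b t)" using h_ge[of t] *(1) by simp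
      finally show ?case .
    qed
    moreover have "filterlim (\<lambda>t. \<bar>?B t\<bar>) at_top at_top"
      by (rule filterlim_at_top_mono[OF lim_top]) (intro always_eventually allI abs_ge_self)
    ultimately have "Liminf at_top (\<lambda>t. h_fun \<eta> (?b t) / ereal \<bar>?B t\<bar>) \<ge> 1"
      by (intro Liminf_quotient_ge_1[OF _ trivial_limit_at_top_linorder])
    then show False
      using Liminf_top by (simp add: not_le[symmetric])
  next
    case 2
    \<comment> \<open>Reversing time and sign together keeps the inequality: the derivative of
      \<open>v\<close> at \<open>t\<close> is \<open>u' (- t)\<close>, the weight becomes
      \<open>\<beta> (- t) r\<close> with primitive \<open>- ?B (- t)\<close>, and \<open>v\<close>
      is positive at \<open>- t\<^sub>0\<close>.\<close>
    define v where "v = (\<lambda>t. - u (- t))"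
    have neg: "(uminus has_real_derivative - 1) (at t)" for t :: real
      by (auto intro!: derivative_eq_intros)
    have dv: "(v has_real_derivative u' (- t)) (at t)" for t
      unfolding v_def using DERIV_minus[OF DERIV_chain2[where g = uminus, OF du neg[of t]]] by simp
    have dB': "((\<lambda>t. - ?B (- t)) has_real_derivative \<beta> (- t) r) (at t)" for t
      using DERIV_minus[OF DERIV_chain2[where g = uminus, OF dB neg[of t]]] by simp
    have v'_ge: "u' (- t) \<ge> \<beta> (- t) r * \<eta> \<bar>v t\<bar>" for t
      using u'_ge[of "- t"] by (simp add: v_def)
    have pos: "v (- t\<^sub>0) > 0" using 2 by (simp add: v_def)
    \<comment> \<open>The comparison is evaluated at time \<open>- t\<close>, where
      \<open>v (- t) = \<bar>u t\<bar>\<close>. The reflected primitive gives the constant the term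
      \<open>+ ?B t\<^sub>0\<close>, and near minus infinity
      \<open>- ?B t = \<bar>?B t\<bar>\<close>.\<close>
    have "\<forall>\<^sub>F t in at_bot. h_fun \<eta> (?b t) \<ge> ereal (H \<bar>u t\<^sub>0\<bar> + ?B t\<^sub>0 + \<bar>?B t\<bar>)"
      using eventually_le_at_bot[of t\<^sub>0] filterlim_at_bot[THEN iffD1, OF lim_bot, rule_format, of 0]
    proof eventually_elim
      case (elim t)
      have "- t\<^sub>0 \<le> - t" using elim(1) by simp
      note * = comparison_lower_bound[of "- t\<^sub>0" v "\<lambda>t. u' (- t)" "\<lambda>t. - ?B (- t)" "\<lambda>t. \<beta> (- t) r" H \<eta>,
          OF dv dB' dH \<eta>_pos v'_ge u'_nonneg pos this]
      then have "ereal (H \<bar>u t\<^sub>0\<bar> + ?B t\<^sub>0 + \<bar>?B t\<bar>) \<le> ereal (H \<bar>u t\<bar>)"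
        using elim(2) 2 by (simp add: v_def)
      also have "\<dots> \<le> h_fun \<eta> (?b t)" using h_ge[of t] *(1) by (simp add: v_def)
      finally show ?case .
    qed
    moreover have "filterlim (\<lambda>t. \<bar>?B t\<bar>) at_top at_bot"
    proof (rule filterlim_at_top_mono)
      show "filterlim (\<lambda>t. - ?B t) at_top at_bot"
        using lim_bot by (simp add: filterlim_uminus_at_top)
    qed (intro always_eventually allI abs_ge_minus_self)
    ultimately have "Liminf at_bot (\<lambda>t. h_fun \<eta> (?b t) / ereal \<bar>?B t\<bar>) \<ge> 1"
      by (intro Liminf_quotient_ge_1[OF _ trivial_limit_at_bot_linorder])
    then show False
      using Liminf_bot by (simp add: not_le[symmetric])
  qed
qed

end
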